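(* Let $K=\{\alpha_n: n\in\mathbb N\}\cup\{0\}$ where $(\alpha_n)_{n\in\mathbb N}$ is a strictly decreasing null sequence in $\mathbb R$, and let $S\subseteq\mathbb Q_{>0}$, ordered as a subset of $\mathbb Q$. Then: (a) $M_0$ is prime Artinian if and only if $-S$ is a well-founded forest with finite width, and the same equivalence holds with $R_S(K)$ in place of $M_0$; (b) $M_0$ is prime Noetherian if and only if $S$ is a well-founded forest with finite width, and the same equivalence holds with $R_S(K)$ in place of $M_0$.
   Context: An (order) ideal of a vector lattice $E$ is a linear subspace $I$ such that $|x|\le|y|$, $x\in E$, $y\in I$ imply $x\in I$. A proper ideal $P$ is prime if $x\wedge y\in P$ implies $x\in P$ or $y\in P$. $E$ is prime Artinian (prime Noetherian) if every decreasing (increasing) sequence of prime ideals of $E$ is stationary, i.e. eventually constant. Put $S_0=S\cup\{0\}$ (with $t^0=1$). $R_S(K)\subseteq C(K)$ is the set of all continuous functions $f:K\to\mathbb R$ for which there are $\varepsilon>0$, $n\in\mathbb N$, $s_0,\dots,s_n\in S_0$ and real $a_0,\dots,a_n$ with $f(t)=\sum_{k=0}^n a_kt^{s_k}$ for all $t\in[0,\varepsilon)\cap K$. It is a vector sublattice of $C(K)$ with the pointwise order. $M_0=\{f\in R_S(K): f(0)=0\}$, an ideal of $R_S(K)$, viewed as a vector lattice. A poset is well-founded if every nonempty subset has a minimal element; it is a forest if the set of elements below any given element is totally ordered; it has finite width if every antichain is finite. $-S=\{-s: s\in S\}$ with the order from $\mathbb Q$. (Since $S$ and $-S$ are totally ordered,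 they are automatically forests of finite width.) *)

theory Defs
  imports Complex_Main "HOL-Library.Function_Algebras"
begin

section \<open>Real-valued functions as a vector lattice\<close>

text \<open>Addition, order and lattice operations on functions are the pointwise ones of the library;
  only the pointwise scalar multiplication is missing there.\<close>

instantiation "fun" :: (type, real_vector) real_vector
begin

definition scaleR_fun :: "real \<Rightarrow> ('a \<Rightarrow> 'b) \<Rightarrow> 'a \<Rightarrow> 'b" where
  "scaleR_fun r f = (\<lambda>x. r *\<^sub>R f x)"

instance
  by standard (simp_all add: scaleR_fun_def plus_fun_def scaleR_add_right scaleR_add_left)

end

instance "fun" :: (type, ordered_real_vector) ordered_real_vector
  by standard (simp_all add: scaleR_fun_def le_fun_def scaleR_left_mono scaleR_right_mono)


section \<open>Prime ideals of vector lattices\<close>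

text \<open>A vector lattice is given as a vector sublattice \<open>E\<close> of an ambient vector lattice \<open>'v\<close>.\<close>

definition modulus :: "'v::{ordered_real_vector, lattice} \<Rightarrow> 'v" where
  "modulus x = sup x (- x)"

definition order_ideal :: "'v::{ordered_real_vector, lattice} set \<Rightarrow> 'v set \<Rightarrow> bool" where
  "order_ideal E I \<longleftrightarrow>
     I \<subseteq> E \<and> subspace I \<and> (\<forall>x\<in>E. \<forall>y\<in>I. modulus x \<le> modulus y \<longrightarrow> x \<in> I)"

definition prime_order_ideal :: "'v::{ordered_real_vector, lattice} set \<Rightarrow> 'v set \<Rightarrow> bool" where
  "prime_order_ideal E P \<longleftrightarrow>
     order_ideal E P \<and> P \<noteq> E \<and> (\<forall>x\<in>E. \<forall>y\<in>E. inf x y \<in> P \<longrightarrow> x \<in> P \<or> y \<in> P)"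

definition stationary :: "(nat \<Rightarrow> 'a) \<Rightarrow> bool" where
  "stationary P \<longleftrightarrow> (\<exists>N. \<forall>n\<ge>N. P n = P N)"

definition prime_artinian :: "'v::{ordered_real_vector, lattice} set \<Rightarrow> bool" where
  "prime_artinian E \<longleftrightarrow>
     (\<forall>P::nat \<Rightarrow> 'v set. (\<forall>n. prime_order_ideal E (P n)) \<and> decseq P \<longrightarrow> stationary P)"

definition prime_noetherian :: "'v::{ordered_real_vector, lattice} set \<Rightarrow> bool" where
  "prime_noetherian E \<longleftrightarrow>
     (\<forall>P::nat \<Rightarrow> 'v set. (\<forall>n. prime_order_ideal E (P n)) \<and> incseq P \<longrightarrow> stationary P)"


section \<open>Posets\<close>

definition well_founded_poset :: "'a::order set \<Rightarrow> bool" where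
  "well_founded_poset A \<longleftrightarrow> (\<forall>X. X \<subseteq> A \<and> X \<noteq> {} \<longrightarrow> (\<exists>m\<in>X. \<forall>x\<in>X. \<not> x < m))"

definition forest :: "'a::order set \<Rightarrow> bool" where
  "forest A \<longleftrightarrow> (\<forall>a\<in>A. totalp_on {x \<in> A. x \<le> a} (\<le>))"

definition antichain :: "'a::order set \<Rightarrow> bool" where
  "antichain B \<longleftrightarrow> (\<forall>x\<in>B. \<forall>y\<in>B. x \<le> y \<longrightarrow> x = y)"

definition finite_width :: "'a::order set \<Rightarrow> bool" where
  "finite_width A \<longleftrightarrow> (\<forall>B. B \<subseteq> A \<and> antichain B \<longrightarrow> finite B)"


section \<open>The function lattices\<close>

text \<open>The convention \<open>t\<^sup>0 = 1\<close> has to be made explicit, since \<open>0 powr 0 = 0\<close>.\<close>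

definition rat_power :: "real \<Rightarrow> rat \<Rightarrow> real" where
  "rat_power t s = (if s = 0 then 1 else t powr of_rat s)"

text \<open>Functions on \<open>K\<close> are represented by functions on the reals that vanish off \<open>K\<close>, so that the
  pointwise operations and order on \<open>real \<Rightarrow> real\<close> restrict to those of \<open>C(K)\<close>.\<close>

definition C_fun :: "real set \<Rightarrow> (real \<Rightarrow> real) set" where
  "C_fun K = {f. continuous_on K f \<and> (\<forall>t. t \<notin> K \<longrightarrow> f t = 0)}"

definition R_fun :: "rat set \<Rightarrow> real set \<Rightarrow> (real \<Rightarrow> real) set" where
  "R_fun S K = {f \<in> C_fun K.
     \<exists>\<epsilon>>0. \<exists>n::nat. \<exists>s::nat \<Rightarrow> rat. \<exists>a::nat \<Rightarrow> real.
       (\<forall>k\<le>n. s k \<in> insert 0 S) \<and>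
       (\<forall>t \<in> {0..<\<epsilon>} \<inter> K. f t = (\<Sum>k\<le>n. a k * rat_power t (s k)))}"

definition M0_fun :: "rat set \<Rightarrow> real set \<Rightarrow> (real \<Rightarrow> real) set" where
  "M0_fun S K = {f \<in> R_fun S K. f 0 = 0}"

end

(*
  A nonzero germ at 0 has a leading term a t^s, so the germs are totally ordered up to sign and their
  archimedean classes are indexed by the exponents.  A prime ideal either misses the indicator
  function of some point of the sequence, and is then the maximal ideal of the functions vanishing
  there, or it contains all of these indicator functions, and is then determined by an upward closed
  set of leading exponents.  Strictly monotone sequences of prime ideals are therefore of the second
  kind and produce strictly monotone sequences of exponents; conversely, an exponent x yields the
  prime ideal of all functions that are o(t^x), and smaller x give strictly larger ideals.
*)

theory Submission
  imports Defs
begin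

section \<open>Pointwise operations on functions\<close>

lemma modulus_fun_apply [simp]: "modulus f t = \<bar>f t\<bar>" for f :: "'a \<Rightarrow> real"
  by (simp add: modulus_def sup_real_def abs_if max_def)

lemma scaleR_fun_apply [simp]: "(r *\<^sub>R f) t = r *\<^sub>R f t"
  by (simp add: scaleR_fun_def)

lemma sum_fun_apply: "(\<Sum>i\<in>A. f i) t = (\<Sum>i\<in>A. f i t)"
  for f :: "'i \<Rightarrow> 'a \<Rightarrow> 'b::comm_monoid_add"
  by (induction A rule: infinite_finite_induct) auto

section \<open>Well-foundedness, forests and width in linear orders\<close>

text \<open>The smaller of \<open>a\<close> and the least element of \<open>X - {a}\<close> is least
  in \<open>X\<close>. This removes the exponent 0, which occurs in \<open>R_fun S K\<close> but
  need not belong to \<open>S\<close>.\<close>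

lemma well_founded_poset_insert_iff:
  fixes a :: "'a::linorder"
  shows "well_founded_poset (insert a A) \<longleftrightarrow> well_founded_poset A"
proof
  assume "well_founded_poset (insert a A)"
  then show "well_founded_poset A"
    unfolding well_founded_poset_def by blast
next
  assume A: "well_founded_poset A"
  show "well_founded_poset (insert a A)"
    unfolding well_founded_poset_def
  proof (intro allI impI)
    fix X assume X: "X \<subseteq> insert a A \<and> X \<noteq> {}"
    show "\<exists>m\<in>X. \<forall>x\<in>X. \<not> x < m"
    proof (cases "X - {a} = {}")
      case True
      then have "X = {a}" using X by blast
      then show ?thesis by simp
    next
      case False
      then obtain m where "m \<in> X - {a}" and "\<forall>x\<in>X - {a}. \<not> x < m"
        using A X unfolding well_founded_poset_def by (metis Diff_subset_conv insert_is_Un)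
      then have "m \<in> X" and m: "\<And>x. x \<in> X \<Longrightarrow> x = a \<or> m \<le> x"
        by (blast, metis DiffI not_less singletonD)
      show ?thesis
      proof (cases "a \<in> X \<and> a < m")
        case True
        then have "\<forall>x\<in>X. \<not> x < a" using m by fastforce
        then show ?thesis using True by blast
      next
        case False
        then have "\<forall>x\<in>X. \<not> x < m" using m by fastforce
        then show ?thesis using \<open>m \<in> X\<close> by blast
      qed
    qed
  qed
qed

lemma forest_linorder: "forest (A :: 'a::linorder set)"
  by (auto simp: forest_def totalp_on_def)

text \<open>Any two elements of a linear order are comparable, so an antichain has at most one
  element.\<close>

lemma finite_width_linorder: "finite_width (A :: 'a::linorder set)"
  unfolding finite_width_def
proof (intro allI impI)
  fix B assume "B \<subseteq> A \<and> antichain B"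
  then have "x = y" if "x \<in> B" "y \<in> B" for x y
    using that linear[of x y] unfolding antichain_def by metis
  then have "B = {} \<or> (\<exists>b. B = {b})" by blast
  then show "finite B" by auto
qed

text \<open>Dependent choice inside a set without minimal element. The resulting sequence of
  exponents is turned into a sequence of prime ideals later.\<close>

lemma not_well_founded_posetE:
  assumes "\<not> well_founded_poset A"
  obtains x where "\<And>i::nat. x i \<in> A" and "\<And>i. x (Suc i) < x i"
proof -
  have "\<exists>X. X \<subseteq> A \<and> X \<noteq> {} \<and> (\<forall>m\<in>X. \<exists>x\<in>X. x < m)"
    using assms unfolding well_founded_poset_def by simp
  then obtain X where X: "X \<subseteq> A" "X \<noteq> {}" "\<forall>m\<in>X. \<exists>x\<in>X. x < m"
    by (elim exE conjE)
  have "\<exists>x. \<forall>i::nat. x i \<in> X \<and> x (Suc i) < x i"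
    by (rule dependent_nat_choice) (use X in blast)+
  then obtain x where "\<And>i::nat. x i \<in> X" "\<And>i. x (Suc i) < x i" by blast
  then show ?thesis using X(1) by (intro that[of x]) auto
qed

section \<open>Non-stationary sequences and basic facts on ideals\<close>

text \<open>Without a jump from \<open>N\<close> on, induction would make the sequence constant
  there. Jumps that occur arbitrarily late are what produces infinitely many exponents.\<close>

lemma not_stationary_Suc:
  assumes "\<not> stationary P"
  shows "\<exists>n\<ge>N. P (Suc n) \<noteq> P n"
proof (rule ccontr)
  assume *: "\<not> ?thesis"
  have "P n = P N" if "n \<ge> N" for n
    using that by (induction n rule: dec_induct) (use * in auto)
  then show False using assms unfolding stationary_def by blast
qed

lemma order_idealD:
  assumes "order_ideal E I"
  shows "I \<subseteq> E" and "subspace I"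
    and "x \<in> E \<Longrightarrow> y \<in> I \<Longrightarrow> modulus x \<le> modulus y \<Longrightarrow> x \<in> I"
proof -
  note * = assms[unfolded order_ideal_def]
  from * show "I \<subseteq> E" and "subspace I" by simp_all
  show "x \<in> I" if "x \<in> E" "y \<in> I" "modulus x \<le> modulus y"
    using *[THEN conjunct2, THEN conjunct2, THEN bspec, OF that(1), THEN bspec, OF that(2)] that(3)
    by (rule mp)
qed

lemma prime_order_idealD:
  assumes "prime_order_ideal E P"
  shows "order_ideal E P" and "P \<noteq> E"
    and "x \<in> E \<Longrightarrow> y \<in> E \<Longrightarrow> inf x y \<in> P \<Longrightarrow> x \<in> P \<or> y \<in> P"
  using assms unfolding prime_order_ideal_def by simp_all

section \<open>The null sequence, powers along it, and continuity on \<open>K\<close>\<close>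

locale decreasing_null_sequence =
  fixes \<alpha> :: "nat \<Rightarrow> real"
  assumes less: "m < n \<Longrightarrow> \<alpha> n < \<alpha> m"
    and null: "\<alpha> \<longlonglongrightarrow> 0"
begin

abbreviation K :: "real set" where
  "K \<equiv> range \<alpha> \<union> {0}"

lemma pos: "\<alpha> n > 0"
proof -
  have "decseq \<alpha>"
    unfolding decseq_def using less by (metis le_less order.strict_implies_order order_refl)
  then have "0 \<le> \<alpha> (Suc n)" using null by (rule decseq_ge)
  \<comment> \<open>The limit bounds the terms only weakly from below; one more strict decrease
    gives positivity.\<close>
  also have "\<alpha> (Suc n) < \<alpha> n" by (rule less) simp
  finally show ?thesis .
qed

lemma less_iff: "\<alpha> m < \<alpha> n \<longleftrightarrow> n < m"
  using less by (metis less_asym linorder_neqE_nat order_less_irrefl)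

lemma eq_iff: "\<alpha> m = \<alpha> n \<longleftrightarrow> m = n"
  using less_iff by (metis less_irrefl linorder_neqE_nat)

lemma rat_power_seq: "rat_power (\<alpha> n) s = \<alpha> n powr of_rat s"
  using pos[of n] by (simp add: rat_power_def)

lemma rat_power_pos: "rat_power (\<alpha> n) s > 0"
  using pos[of n] by (simp add: rat_power_seq)

lemma rat_power_diff: "rat_power (\<alpha> n) s / rat_power (\<alpha> n) r = rat_power (\<alpha> n) (s - r)"
  using pos[of n] by (simp add: rat_power_seq powr_diff of_rat_diff)

lemma rat_power_tendsto:
  assumes "s \<ge> 0"
  shows "(\<lambda>n. rat_power (\<alpha> n) s) \<longlonglongrightarrow> rat_power 0 s"
proof (cases "s = 0")
  case False
  then have "(\<lambda>n. \<alpha> n powr of_rat s) \<longlonglongrightarrow> 0"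
    using assms by (intro tendsto_zero_powrI[OF null tendsto_const])
      (auto simp: pos less_imp_le)
  then show ?thesis using False by (simp add: rat_power_def)
qed (simp add: rat_power_def)

lemma rat_power_tendsto_0: "s > 0 \<Longrightarrow> (\<lambda>n. rat_power (\<alpha> n) s) \<longlonglongrightarrow> 0"
  using rat_power_tendsto[of s] by (simp add: rat_power_def)

text \<open>Every point of \<open>K\<close> except 0 is isolated, so continuity is a condition at 0
  only, and 0 is approached within \<open>K\<close> only along the sequence.\<close>

lemma continuous_on_K_iff: "continuous_on K f \<longleftrightarrow> (\<lambda>n. f (\<alpha> n)) \<longlonglongrightarrow> f 0"
  for f :: "real \<Rightarrow> real"
proof
  assume "continuous_on K f"
  then show "(\<lambda>n. f (\<alpha> n)) \<longlonglongrightarrow> f 0"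
    by (rule continuous_on_tendsto_compose[OF _ null]) auto
next
  assume lim: "(\<lambda>n. f (\<alpha> n)) \<longlonglongrightarrow> f 0"
  show "continuous_on K f"
    unfolding continuous_on_def tendsto_iff eventually_at
  proof (intro ballI allI impI)
    fix x e :: real assume x: "x \<in> K" and e: "e > 0"
    show "\<exists>d>0. \<forall>x'\<in>K. x' \<noteq> x \<and> dist x' x < d \<longrightarrow> dist (f x') (f x) < e"
    proof (cases "x = 0")
      case True
      obtain N where N: "\<And>n. n \<ge> N \<Longrightarrow> dist (f (\<alpha> n)) (f 0) < e"
        using lim e unfolding lim_sequentially by blast
      have "dist (f x') (f x) < e" if "x' \<in> K" "dist x' x < \<alpha> N" for x'
        using that True e N by (auto simp: less_iff dist_real_def abs_of_pos[OF pos])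
      then show ?thesis using pos[of N] by blast
    next
      case False
      then obtain n where n: "x = \<alpha> n" using x by blast
      \<comment> \<open>The distance from \<open>\<alpha> n\<close> to its nearest neighbour in the
        sequence. The largest point \<open>\<alpha> 0\<close> has no upper neighbour, and 1 stands
        in for that gap.\<close>
      define d where "d = min (\<alpha> n - \<alpha> (Suc n)) (if n = 0 then 1 else \<alpha> (n - 1) - \<alpha> n)"
      have d: "d > 0" by (auto simp: d_def less_iff)
      have "x' = x" if "x' \<in> K" "dist x' x < d" for x'
      proof (rule ccontr)
        assume "x' \<noteq> x"
        \<comment> \<open>Any other point of \<open>K\<close> lies at or beyond one of the two
          neighbours of \<open>\<alpha> n\<close>.\<close>
        then consider "x' \<le> \<alpha> (Suc n)" | "n > 0" "x' \<ge> \<alpha> (n - 1)"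
        proof -
          assume a: "x' \<le> \<alpha> (Suc n) \<Longrightarrow> thesis" "0 < n \<Longrightarrow> \<alpha> (n - 1) \<le> x' \<Longrightarrow> thesis"
          show thesis
          proof (cases "x' = 0")
            case True then show ?thesis using a(1) pos[of "Suc n"] by simp
          next
            case False
            then obtain m where m: "x' = \<alpha> m" using \<open>x' \<in> K\<close> by blast
            with \<open>x' \<noteq> x\<close> n consider "n < m" | "m < n" by (cases m n rule: linorder_cases) auto
            then show ?thesis
            proof cases
              case 1
              then have "\<not> \<alpha> (Suc n) < \<alpha> m" by (simp add: less_iff)
              then show ?thesis using a(1) m by simp
            next
              case 2
              then have "\<not> \<alpha> m < \<alpha> (n - 1)" by (simp add: less_iff)
              then show ?thesis using a(2) m 2 by simp
            qed
          qed
        qed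
        then show False
          using that(2) n by cases (auto simp: d_def dist_real_def)
      qed
      then show ?thesis using d by blast
    qed
  qed
qed

section \<open>Germs at 0 and their leading terms\<close>

text \<open>Germs are represented by sequences along \<open>\<alpha>\<close>, with equality taken at
  every index. The set \<open>T\<close> of exponents is a parameter so that \<open>T = S\<close> and
  \<open>T = insert 0 S\<close> are treated together.\<close>

definition germs :: "rat set \<Rightarrow> (nat \<Rightarrow> real) set" where
  "germs T = span ((\<lambda>s n. rat_power (\<alpha> n) s) ` T)"

text \<open>Only the values along the sequence are prescribed, and only eventually; continuity then
  determines the value at 0.\<close>

definition germ_fun :: "rat set \<Rightarrow> (real \<Rightarrow> real) set" where
  "germ_fun T = {f \<in> C_fun K. \<exists>h\<in>germs T. \<forall>\<^sub>F n in sequentially. f (\<alpha> n) = h n}"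

lemma germ_funI:
  "f \<in> C_fun K \<Longrightarrow> h \<in> germs T \<Longrightarrow> \<forall>\<^sub>F n in sequentially. f (\<alpha> n) = h n \<Longrightarrow> f \<in> germ_fun T"
  unfolding germ_fun_def by blast

lemma germs_sumE:
  assumes "h \<in> germs T"
  obtains A c where "finite A" "A \<subseteq> T" "h = (\<lambda>n. \<Sum>s\<in>A. c s * rat_power (\<alpha> n) s)"
proof -
  let ?b = "\<lambda>s n. rat_power (\<alpha> n) s"
  obtain B r where B: "finite B" "B \<subseteq> ?b ` T" and h: "h = (\<Sum>b\<in>B. r b *\<^sub>R b)"
    using assms unfolding germs_def span_explicit by blast
  \<comment> \<open>One exponent is chosen for each basis sequence, so that the sum over sequences
    can be reindexed by exponents.\<close>
  obtain A where A: "A \<subseteq> T" "inj_on ?b A" "B = ?b ` A"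
    using B(2) unfolding subset_image_inj by (elim exE conjE)
  then have "finite A" using B(1) finite_imageD by blast
  moreover have "h = (\<lambda>n. \<Sum>s\<in>A. r (?b s) * rat_power (\<alpha> n) s)"
    unfolding h A(3) by (simp add: fun_eq_iff sum.reindex[OF A(2)] sum_fun_apply)
  ultimately show ?thesis using A(1) by (intro that[of A "\<lambda>s. r (?b s)"])
qed

lemma germs_sumI:
  assumes "\<And>k. k \<in> A \<Longrightarrow> s k \<in> T"
  shows "(\<lambda>n. \<Sum>k\<in>A. a k * rat_power (\<alpha> n) (s k)) \<in> germs T"
proof -
  have "(\<Sum>k\<in>A. a k *\<^sub>R (\<lambda>n. rat_power (\<alpha> n) (s k))) \<in> germs T"
    unfolding germs_def using assms by (intro span_sum span_scale span_base) auto
  also have "(\<Sum>k\<in>A. a k *\<^sub>R (\<lambda>n. rat_power (\<alpha> n) (s k)))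
      = (\<lambda>n. \<Sum>k\<in>A. a k * rat_power (\<alpha> n) (s k))"
    by (simp add: fun_eq_iff sum_fun_apply)
  finally show ?thesis .
qed

text \<open>After division by the power with the smallest exponent that really occurs, all other
  summands are positive powers and tend to 0; the coefficient of the smallest exponent
  remains.\<close>

lemma germs_leading_term:
  assumes "h \<in> germs T" and nz: "h \<noteq> 0"
  obtains s a where "s \<in> T" "a \<noteq> 0" "(\<lambda>n. h n / rat_power (\<alpha> n) s) \<longlonglongrightarrow> a"
proof -
  obtain A c where A: "finite A" "A \<subseteq> T"
    and h: "h = (\<lambda>n. \<Sum>s\<in>A. c s * rat_power (\<alpha> n) s)"
    by (rule germs_sumE[OF assms(1)])
  \<comment> \<open>Vanishing coefficients are discarded first, so that the minimal exponent has a
    nonzero coefficient.\<close>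
  define B where "B = {s\<in>A. c s \<noteq> 0}"
  have B: "finite B" "B \<subseteq> T" "\<And>s. s \<in> B \<Longrightarrow> c s \<noteq> 0" using A by (auto simp: B_def)
  have hB: "h n = (\<Sum>s\<in>B. c s * rat_power (\<alpha> n) s)" for n
    unfolding h B_def by (rule sum.mono_neutral_right) (use A in auto)
  have "B \<noteq> {}" using nz hB by (auto simp: fun_eq_iff)
  define m where "m = Min B"
  have m: "m \<in> B" "\<And>s. s \<in> B \<Longrightarrow> m \<le> s" using \<open>B \<noteq> {}\<close> B(1) by (auto simp: m_def)
  have "(\<lambda>n. \<Sum>s\<in>B. c s * rat_power (\<alpha> n) (s - m))
      \<longlonglongrightarrow> (\<Sum>s\<in>B. c s * rat_power 0 (s - m))"
    using m(2) by (intro tendsto_intros rat_power_tendsto) simp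
  \<comment> \<open>By the convention for exponent 0, \<open>rat_power 0 (s - m)\<close> is 1 at
    \<open>s = m\<close> and 0 otherwise.\<close>
  moreover have "(\<Sum>s\<in>B. c s * rat_power 0 (s - m)) = (\<Sum>s\<in>B. if s = m then c s else 0)"
    by (intro sum.cong) (auto simp: rat_power_def)
  moreover have "(\<Sum>s\<in>B. c s * rat_power (\<alpha> n) (s - m)) = h n / rat_power (\<alpha> n) m" for n
    unfolding hB sum_divide_distrib by (simp flip: rat_power_diff)
  ultimately have "(\<lambda>n. h n / rat_power (\<alpha> n) m) \<longlonglongrightarrow> c m"
    using B(1) m(1) by simp
  then show ?thesis using m(1) B(2,3) by (intro that[of m "c m"]) auto
qed

section \<open>The two function lattices in terms of germs\<close>

lemma C_fun_iff: "f \<in> C_fun K \<longleftrightarrow> (\<lambda>n. f (\<alpha> n)) \<longlonglongrightarrow> f 0 \<and> (\<forall>t. t \<notin> K \<longrightarrow> f t = 0)"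
  by (simp only: C_fun_def continuous_on_K_iff mem_Collect_eq)

text \<open>The points of \<open>K\<close> in a small interval at 0 are 0 and a tail of the
  sequence. On the tail both descriptions agree, and at 0 the identity follows by passing to the
  limit.\<close>

lemma R_fun_eq_germ_fun:
  assumes S: "S \<subseteq> {0<..}"
  shows "R_fun S K = germ_fun (insert 0 S)"
proof (intro equalityI subsetI)
  fix f assume "f \<in> R_fun S K"
  then obtain e n s a where f: "f \<in> C_fun K" and e: "e > 0"
    and s: "\<forall>k\<le>n. s k \<in> insert 0 S"
    and eq: "\<forall>t \<in> {0..<e} \<inter> K. f t = (\<Sum>k\<le>n::nat. a k * rat_power t (s k))"
    unfolding R_fun_def by blast
  have "\<forall>\<^sub>F i in sequentially. \<alpha> i < e" using null e by (rule order_tendstoD)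
  then have "\<forall>\<^sub>F i in sequentially. f (\<alpha> i) = (\<Sum>k\<le>n. a k * rat_power (\<alpha> i) (s k))"
    by eventually_elim (use eq pos in \<open>simp add: less_imp_le\<close>)
  moreover have "(\<lambda>i. \<Sum>k\<le>n. a k * rat_power (\<alpha> i) (s k)) \<in> germs (insert 0 S)"
    by (rule germs_sumI) (use s in auto)
  ultimately show "f \<in> germ_fun (insert 0 S)"
    using f germ_funI by blast
next
  fix f assume "f \<in> germ_fun (insert 0 S)"
  then obtain h where f: "f \<in> C_fun K" and h: "h \<in> germs (insert 0 S)"
    and fh: "\<forall>\<^sub>F n in sequentially. f (\<alpha> n) = h n"
    unfolding germ_fun_def by blast
  obtain A c where A: "finite A" "A \<subseteq> insert 0 S"
    and hA: "h = (\<lambda>n. \<Sum>s\<in>A. c s * rat_power (\<alpha> n) s)"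
    by (rule germs_sumE[OF h])
  define p where "p t = (\<Sum>s\<in>A. c s * rat_power t s)" for t
  have "h \<longlonglongrightarrow> p 0"
    unfolding hA p_def using A S by (intro tendsto_intros rat_power_tendsto) force
  then have "(\<lambda>n. f (\<alpha> n)) \<longlonglongrightarrow> p 0"
    by (rule Lim_transform_eventually) (use fh in \<open>simp add: eq_commute\<close>)
  then have f0: "f 0 = p 0" using f unfolding C_fun_iff by (blast intro: LIMSEQ_unique)
  obtain N where N: "\<And>n. n \<ge> N \<Longrightarrow> f (\<alpha> n) = p (\<alpha> n)"
    using fh unfolding eventually_sequentially p_def hA by blast
  have fp: "f t = p t" if "t \<in> {0..<\<alpha> N} \<inter> K" for t
    using that N f0 by (auto simp: less_iff)
  obtain g where g: "bij_betw g {0..<card A} A"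
    using ex_bij_betw_nat_finite[OF A(1)] by blast
  \<comment> \<open>The sum over \<open>{..card A}\<close> has one index more than \<open>A\<close>
    has elements; the surplus summand receives exponent 0 and coefficient 0. This also covers an
    empty \<open>A\<close>.\<close>
  define s where "s k = (if k < card A then g k else 0)" for k
  define a where "a k = (if k < card A then c (g k) else 0)" for k
  have s: "\<forall>k\<le>card A. s k \<in> insert 0 S"
    using g A(2) unfolding s_def bij_betw_def by auto
  have "p t = (\<Sum>k\<le>card A. a k * rat_power t (s k))" for t
  proof -
    have "p t = (\<Sum>k\<in>{0..<card A}. c (g k) * rat_power t (g k))"
      unfolding p_def by (rule sum.reindex_bij_betw[OF g, symmetric])
    also have "\<dots> = (\<Sum>k\<le>card A. a k * rat_power t (s k))"
      by (rule sum.mono_neutral_cong_left) (auto simp: a_def s_def)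
    finally show ?thesis .
  qed
  with fp have eq: "\<forall>t \<in> {0..<\<alpha> N} \<inter> K. f t = (\<Sum>k\<le>card A. a k * rat_power t (s k))"
    by simp
  show "f \<in> R_fun S K"
    unfolding R_fun_def
    by (intro CollectI conjI exI[of _ "\<alpha> N"] exI[of _ "card A"] exI[of _ s] exI[of _ a])
      (fact f, fact pos, fact s, fact eq)
qed

text \<open>All exponents in \<open>S\<close> are positive, so the corresponding powers tend to 0
  and the value at 0 is the constant coefficient. Vanishing at 0 therefore means that exponent 0
  does not occur.\<close>

lemma M0_fun_eq_germ_fun:
  assumes S: "S \<subseteq> {0<..}"
  shows "M0_fun S K = germ_fun S"
proof -
  have lim: "h \<longlonglongrightarrow> 0" if hS: "h \<in> germs S" for h
  proof -
    obtain A c where A: "finite A" "A \<subseteq> S"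
      and h: "h = (\<lambda>n. \<Sum>s\<in>A. c s * rat_power (\<alpha> n) s)"
      by (rule germs_sumE[OF hS])
    show ?thesis
      unfolding h using A S by (intro tendsto_null_sum tendsto_mult_right_zero rat_power_tendsto_0) auto
  qed
  have "f \<in> germ_fun S \<longleftrightarrow> f \<in> germ_fun (insert 0 S) \<and> f 0 = 0" for f
  proof (intro iffI conjI)
    assume f: "f \<in> germ_fun S"
    then obtain h where "h \<in> germs S" and fh: "\<forall>\<^sub>F n in sequentially. f (\<alpha> n) = h n"
      and fC: "f \<in> C_fun K"
      unfolding germ_fun_def by blast
    have "(\<lambda>n. f (\<alpha> n)) \<longlonglongrightarrow> 0"
      by (rule Lim_transform_eventually[OF lim[OF \<open>h \<in> germs S\<close>]])
        (use fh in \<open>simp add: eq_commute\<close>)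
    then show "f 0 = 0" using fC unfolding C_fun_iff by (blast intro: LIMSEQ_unique)
    have "germs S \<subseteq> germs (insert 0 S)" unfolding germs_def by (intro span_mono) auto
    then show "f \<in> germ_fun (insert 0 S)" using f unfolding germ_fun_def by blast
  next
    assume "f \<in> germ_fun (insert 0 S) \<and> f 0 = 0"
    then obtain h where h: "h \<in> germs (insert 0 S)"
      and fh: "\<forall>\<^sub>F n in sequentially. f (\<alpha> n) = h n"
      and fC: "f \<in> C_fun K" and f0: "f 0 = 0"
      unfolding germ_fun_def by blast
    \<comment> \<open>The constant term \<open>k\<close> is split off. Computing the limit of
      \<open>f - k\<close> once from the remaining germ and once by continuity gives
      \<open>k = 0\<close>.\<close>
    obtain k where k: "h - k *\<^sub>R (\<lambda>n. rat_power (\<alpha> n) 0) \<in> germs S"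
      using h unfolding germs_def by (auto simp: span_breakdown_eq)
    have "(\<lambda>n. f (\<alpha> n) - k) \<longlonglongrightarrow> 0"
      by (rule Lim_transform_eventually[OF lim[OF k]])
        (use fh in \<open>eventually_elim, simp add: rat_power_def\<close>)
    moreover have "(\<lambda>n. f (\<alpha> n) - k) \<longlonglongrightarrow> 0 - k"
      using fC f0 unfolding C_fun_iff by (intro tendsto_intros) auto
    ultimately have "0 = 0 - k" by (rule LIMSEQ_unique)
    then have "h \<in> germs S" using k by simp
    then show "f \<in> germ_fun S" using fC fh by (intro germ_funI)
  qed
  then show ?thesis
    unfolding M0_fun_def R_fun_eq_germ_fun[OF S] by blast
qed

section \<open>Linear and lattice structure of \<open>germ_fun T\<close>\<close>

lemma subspace_germ_fun: "subspace (germ_fun T)"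
proof (rule subspaceI)
  show "0 \<in> germ_fun T"
    unfolding germ_fun_def C_fun_iff germs_def by (auto intro!: bexI[of _ 0] span_zero)
next
  fix f g assume "f \<in> germ_fun T" "g \<in> germ_fun T"
  then obtain h k where f: "f \<in> C_fun K" "h \<in> germs T" "\<forall>\<^sub>F n in sequentially. f (\<alpha> n) = h n"
    and g: "g \<in> C_fun K" "k \<in> germs T" "\<forall>\<^sub>F n in sequentially. g (\<alpha> n) = k n"
    unfolding germ_fun_def by blast
  have "\<forall>\<^sub>F n in sequentially. (f + g) (\<alpha> n) = (h + k) n"
    using f(3) g(3) by eventually_elim simp
  moreover have "h + k \<in> germs T" using f(2) g(2) unfolding germs_def by (rule span_add)
  moreover have "f + g \<in> C_fun K"
    using f(1) g(1) unfolding C_fun_iff by (auto intro: tendsto_add)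
  ultimately show "f + g \<in> germ_fun T" unfolding germ_fun_def by blast
next
  fix c :: real and f assume "f \<in> germ_fun T"
  then obtain h where f: "f \<in> C_fun K" "h \<in> germs T" "\<forall>\<^sub>F n in sequentially. f (\<alpha> n) = h n"
    unfolding germ_fun_def by blast
  have "\<forall>\<^sub>F n in sequentially. (c *\<^sub>R f) (\<alpha> n) = (c *\<^sub>R h) n"
    using f(3) by eventually_elim simp
  moreover have "c *\<^sub>R h \<in> germs T" using f(2) unfolding germs_def by (rule span_scale)
  moreover have "c *\<^sub>R f \<in> C_fun K"
    using f(1) unfolding C_fun_iff by (auto intro: tendsto_mult_left)
  ultimately show "c *\<^sub>R f \<in> germ_fun T" unfolding germ_fun_def by blast
qed

lemma germ_fun_leading_term:
  assumes "f \<in> germ_fun T"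
  shows "(\<forall>\<^sub>F n in sequentially. f (\<alpha> n) = 0) \<or>
    (\<exists>s\<in>T. \<exists>a. a \<noteq> 0 \<and> (\<lambda>n. f (\<alpha> n) / rat_power (\<alpha> n) s) \<longlonglongrightarrow> a)"
proof -
  obtain h where h: "h \<in> germs T" "\<forall>\<^sub>F n in sequentially. f (\<alpha> n) = h n"
    using assms unfolding germ_fun_def by blast
  show ?thesis
  proof (cases "h = 0")
    case True then show ?thesis using h(2) by simp
  next
    case False
    then obtain s a where sa: "s \<in> T" "a \<noteq> 0" "(\<lambda>n. h n / rat_power (\<alpha> n) s) \<longlonglongrightarrow> a"
      using germs_leading_term[OF h(1)] by blast
    have "(\<lambda>n. f (\<alpha> n) / rat_power (\<alpha> n) s) \<longlonglongrightarrow> a"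
      by (rule Lim_transform_eventually[OF sa(3)]) (use h(2) in \<open>eventually_elim, simp\<close>)
    then show ?thesis using sa by blast
  qed
qed

text \<open>The sign of the leading coefficient decides. This is the total order of germs, used for
  closure under the modulus and for primality.\<close>

lemma germ_fun_sign:
  assumes "f \<in> germ_fun T"
  shows "(\<forall>\<^sub>F n in sequentially. 0 \<le> f (\<alpha> n)) \<or> (\<forall>\<^sub>F n in sequentially. f (\<alpha> n) \<le> 0)"
  using germ_fun_leading_term[OF assms]
proof (elim disjE bexE exE conjE)
  assume "\<forall>\<^sub>F n in sequentially. f (\<alpha> n) = 0"
  then have "\<forall>\<^sub>F n in sequentially. 0 \<le> f (\<alpha> n)" by eventually_elim simp
  then show ?thesis ..
next
  fix s a assume "a \<noteq> 0" and lim: "(\<lambda>n. f (\<alpha> n) / rat_power (\<alpha> n) s) \<longlonglongrightarrow> a"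
  then consider "0 < a" | "a < 0" by linarith
  then show ?thesis
  proof cases
    case 1
    from order_tendstoD(1)[OF lim 1] have "\<forall>\<^sub>F n in sequentially. 0 \<le> f (\<alpha> n)"
      by eventually_elim (simp add: pos_less_divide_eq[OF rat_power_pos])
    then show ?thesis ..
  next
    case 2
    from order_tendstoD(2)[OF lim 2] have "\<forall>\<^sub>F n in sequentially. f (\<alpha> n) \<le> 0"
      by eventually_elim (simp add: pos_divide_less_eq[OF rat_power_pos])
    then show ?thesis ..
  qed
qed

text \<open>By the eventual sign, the germ of the modulus is that of \<open>f\<close> or of
  \<open>- f\<close>.\<close>

lemma modulus_germ_fun:
  assumes f: "f \<in> germ_fun T"
  shows "modulus f \<in> germ_fun T"
proof -
  have "\<exists>g\<in>germ_fun T. \<forall>\<^sub>F n in sequentially. modulus f (\<alpha> n) = g (\<alpha> n)"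
    using germ_fun_sign[OF f]
  proof
    assume "\<forall>\<^sub>F n in sequentially. 0 \<le> f (\<alpha> n)"
    then have "\<forall>\<^sub>F n in sequentially. modulus f (\<alpha> n) = f (\<alpha> n)" by eventually_elim simp
    then show ?thesis using f by blast
  next
    assume "\<forall>\<^sub>F n in sequentially. f (\<alpha> n) \<le> 0"
    then have "\<forall>\<^sub>F n in sequentially. modulus f (\<alpha> n) = (- f) (\<alpha> n)" by eventually_elim simp
    then show ?thesis using subspace_neg[OF subspace_germ_fun f] by blast
  qed
  then obtain g h where g: "\<forall>\<^sub>F n in sequentially. modulus f (\<alpha> n) = g (\<alpha> n)"
    and h: "h \<in> germs T" "\<forall>\<^sub>F n in sequentially. g (\<alpha> n) = h n"
    unfolding germ_fun_def by blast
  have "\<forall>\<^sub>F n in sequentially. modulus f (\<alpha> n) = h n"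
    using g h(2) by eventually_elim simp
  moreover have "modulus f \<in> C_fun K"
    using f unfolding germ_fun_def C_fun_iff by (auto intro: tendsto_rabs)
  ultimately show ?thesis using h(1) unfolding germ_fun_def by blast
qed

section \<open>Point masses and monomials\<close>

definition point_mass :: "nat \<Rightarrow> real \<Rightarrow> real" where
  "point_mass n t = (if t = \<alpha> n then 1 else 0)"

lemma point_mass_seq: "point_mass n (\<alpha> m) = (if m = n then 1 else 0)"
  by (simp add: point_mass_def eq_iff)

lemma point_mass_germ_fun: "point_mass n \<in> germ_fun T"
proof -
  have ev: "\<forall>\<^sub>F m in sequentially. point_mass n (\<alpha> m) = 0"
    using eventually_gt_at_top[of n] by eventually_elim (simp add: point_mass_seq)
  then have "(\<lambda>m. point_mass n (\<alpha> m)) \<longlonglongrightarrow> 0"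
    by (rule tendsto_eventually)
  moreover have "point_mass n 0 = 0" using pos[of n] by (simp add: point_mass_def)
  ultimately have "point_mass n \<in> C_fun K"
    unfolding C_fun_iff by (auto simp: point_mass_def)
  moreover have "0 \<in> germs T" unfolding germs_def by (rule span_zero)
  ultimately show ?thesis
    by (rule germ_funI) (use ev in simp)
qed

definition monomial :: "rat \<Rightarrow> real \<Rightarrow> real" where
  "monomial s t = (if t \<in> K then rat_power t s else 0)"

lemma monomial_germ_fun:
  assumes "s \<in> T" "s \<ge> 0"
  shows "monomial s \<in> germ_fun T"
proof -
  have "monomial s \<in> C_fun K"
    using rat_power_tendsto[OF assms(2)] unfolding C_fun_iff by (simp add: monomial_def)
  moreover have "(\<lambda>n. rat_power (\<alpha> n) s) \<in> germs T"
    unfolding germs_def using assms(1) by (intro span_base) auto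
  ultimately show ?thesis
    by (rule germ_funI) (simp add: monomial_def)
qed

section \<open>Prime ideals and leading exponents\<close>

text \<open>A member of \<open>P\<close> that is nonzero at \<open>\<alpha> n\<close> has a multiple
  dominating the point mass, which would put the point mass into \<open>P\<close>. A function
  vanishing at \<open>\<alpha> n\<close> has modulus disjoint from the point mass, so primality puts
  that modulus into \<open>P\<close>.\<close>

lemma prime_omits_point_mass:
  assumes P: "prime_order_ideal (germ_fun T) P" and n: "point_mass n \<notin> P"
  shows "P = {f \<in> germ_fun T. f (\<alpha> n) = 0}"
proof -
  note prime = prime_order_idealD(3)[OF P]
  note sub = order_idealD(1)[OF prime_order_idealD(1)[OF P]]
    and ss = order_idealD(2)[OF prime_order_idealD(1)[OF P]]
    and dom = order_idealD(3)[OF prime_order_idealD(1)[OF P]]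
  have "f (\<alpha> n) = 0" if "f \<in> P" for f
  proof (rule ccontr)
    assume "f (\<alpha> n) \<noteq> 0"
    then have "modulus (point_mass n) \<le> modulus ((1 / f (\<alpha> n)) *\<^sub>R f)"
      by (auto simp: le_fun_def point_mass_def abs_mult)
    moreover have "(1 / f (\<alpha> n)) *\<^sub>R f \<in> P" using ss that by (rule subspace_scale)
    ultimately show False using dom point_mass_germ_fun n by blast
  qed
  moreover have "f \<in> P" if f: "f \<in> germ_fun T" and "f (\<alpha> n) = 0" for f
  proof -
    have "inf (modulus f) (point_mass n) = 0"
      using that by (auto simp: fun_eq_iff point_mass_def inf_real_def)
    then have "modulus f \<in> P"
      using prime[OF modulus_germ_fun[OF f] point_mass_germ_fun[of n]] n subspace_0[OF ss] by auto
    then show ?thesis by (rule dom[OF f]) (simp add: le_fun_def)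
  qed
  ultimately show ?thesis using sub by blast
qed

text \<open>An ideal containing all point masses ignores finitely many values, so domination on a
  tail suffices.\<close>

lemma order_ideal_eventually_le:
  assumes P: "order_ideal (germ_fun T) P" and e: "\<And>n. point_mass n \<in> P"
    and f: "f \<in> P" and g: "g \<in> germ_fun T"
    and le: "\<forall>\<^sub>F n in sequentially. \<bar>g (\<alpha> n)\<bar> \<le> \<bar>f (\<alpha> n)\<bar>"
  shows "g \<in> P"
proof -
  note sub = order_idealD(1)[OF P] and ss = order_idealD(2)[OF P] and dom = order_idealD(3)[OF P]
  obtain N where N: "\<And>n. n \<ge> N \<Longrightarrow> \<bar>g (\<alpha> n)\<bar> \<le> \<bar>f (\<alpha> n)\<bar>"
    using le unfolding eventually_sequentially by blast
  \<comment> \<open>\<open>b\<close> copies \<open>g\<close> at the first \<open>N\<close> points.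
    Then \<open>g - b\<close> is dominated by \<open>f\<close> along the whole sequence, and at 0 by
    passing to the limit.\<close>
  define b where "b = (\<Sum>n<N. g (\<alpha> n) *\<^sub>R point_mass n)"
  have bP: "b \<in> P"
    unfolding b_def by (intro subspace_sum[OF ss] subspace_scale[OF ss] e)
  have gb: "g - b \<in> germ_fun T"
    using subspace_diff[OF subspace_germ_fun g] bP sub by blast
  have b: "b (\<alpha> m) = (if m < N then g (\<alpha> m) else 0)" for m
    by (simp add: b_def sum_fun_apply point_mass_seq if_distrib cong: if_cong)
  have le': "\<bar>(g - b) (\<alpha> m)\<bar> \<le> \<bar>f (\<alpha> m)\<bar>" for m
    using N[of m] by (simp add: b)
  have lims: "(\<lambda>n. (g - b) (\<alpha> n)) \<longlonglongrightarrow> (g - b) 0" "(\<lambda>n. f (\<alpha> n)) \<longlonglongrightarrow> f 0"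
    using gb f sub unfolding germ_fun_def C_fun_iff by blast+
  have "\<bar>(g - b) 0\<bar> \<le> \<bar>f 0\<bar>"
    by (rule LIMSEQ_le[OF tendsto_rabs[OF lims(1)] tendsto_rabs[OF lims(2)]]) (use le' in blast)
  moreover have "(g - b) t = 0" if "t \<notin> K" for t
    using gb that unfolding germ_fun_def C_fun_iff by blast
  ultimately have "\<bar>(g - b) t\<bar> \<le> \<bar>f t\<bar>" for t
    using le' by (cases "t \<in> K") auto
  then have "g - b \<in> P" by (intro dom[OF gb f]) (simp add: le_fun_def)
  then have "g - b + b \<in> P" using bP by (rule subspace_add[OF ss])
  then show ?thesis by simp
qed

text \<open>If \<open>r\<close> were at least \<open>s\<close>, then \<open>g / f\<close> would be
  bounded along a tail, and a multiple of \<open>f\<close> would dominate \<open>g\<close> there,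
  forcing \<open>g\<close> into \<open>P\<close>.\<close>

lemma leading_exponent_less:
  assumes P: "order_ideal (germ_fun T) P" and e: "\<And>n. point_mass n \<in> P"
    and f: "f \<in> P" and g: "g \<in> germ_fun T" "g \<notin> P"
    and lf: "a \<noteq> 0" "(\<lambda>n. f (\<alpha> n) / rat_power (\<alpha> n) s) \<longlonglongrightarrow> a"
    and lg: "(\<lambda>n. g (\<alpha> n) / rat_power (\<alpha> n) r) \<longlonglongrightarrow> b"
  shows "r < s"
proof (rule ccontr)
  assume "\<not> r < s"
  then have "r - s \<ge> 0" by simp
  \<comment> \<open>The absolute value is the limit of the quotient \<open>|g / f|\<close>. Adding 1
    puts \<open>c\<close> strictly above that limit and makes it positive.\<close>
  define c where "c = \<bar>b / a * rat_power 0 (r - s)\<bar> + 1"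
  have "(\<lambda>n. \<bar>(g (\<alpha> n) / rat_power (\<alpha> n) r) / (f (\<alpha> n) / rat_power (\<alpha> n) s) * rat_power (\<alpha> n) (r - s)\<bar>)
      \<longlonglongrightarrow> \<bar>b / a * rat_power 0 (r - s)\<bar>"
    by (intro tendsto_intros lf lg rat_power_tendsto \<open>r - s \<ge> 0\<close>)
  then have "\<forall>\<^sub>F n in sequentially. \<bar>(g (\<alpha> n) / rat_power (\<alpha> n) r) / (f (\<alpha> n) / rat_power (\<alpha> n) s)
      * rat_power (\<alpha> n) (r - s)\<bar> < c"
    by (rule order_tendstoD) (simp add: c_def)
  moreover have "\<forall>\<^sub>F n in sequentially. f (\<alpha> n) / rat_power (\<alpha> n) s \<noteq> 0"
    using lf(2,1) by (rule tendsto_imp_eventually_ne)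
  ultimately have "\<forall>\<^sub>F n in sequentially. \<bar>g (\<alpha> n)\<bar> \<le> \<bar>(c *\<^sub>R f) (\<alpha> n)\<bar>"
  proof eventually_elim
    case (elim n)
    have "f (\<alpha> n) \<noteq> 0" using elim(2) by auto
    have "(g (\<alpha> n) / rat_power (\<alpha> n) r) / (f (\<alpha> n) / rat_power (\<alpha> n) s) * rat_power (\<alpha> n) (r - s)
        = g (\<alpha> n) / f (\<alpha> n)"
      using rat_power_pos[of n r] rat_power_pos[of n s]
      by (simp flip: rat_power_diff add: field_simps)
    then have "\<bar>g (\<alpha> n)\<bar> / \<bar>f (\<alpha> n)\<bar> < c" using elim(1) by simp
    then have "\<bar>g (\<alpha> n)\<bar> \<le> c * \<bar>f (\<alpha> n)\<bar>" using \<open>f (\<alpha> n) \<noteq> 0\<close> by (simp add: field_simps)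
    moreover have "c > 0"
      using abs_ge_zero[of "b / a * rat_power 0 (r - s)"] unfolding c_def by linarith
    ultimately show ?case by (simp add: abs_mult)
  qed
  moreover have "c *\<^sub>R f \<in> P"
    by (rule subspace_scale[OF order_idealD(2)[OF P] f])
  ultimately show False using order_ideal_eventually_le[OF P e _ g(1)] g(2) by blast
qed

text \<open>A function whose germ is zero is dominated by 0 on a tail and so belongs to
  \<open>P\<close>; outside \<open>P\<close> the leading term exists.\<close>

lemma leading_term_notin_ideal:
  assumes P: "order_ideal (germ_fun T) P" and e: "\<And>n. point_mass n \<in> P"
    and g: "g \<in> germ_fun T" "g \<notin> P"
  obtains s a where "s \<in> T" "a \<noteq> 0" "(\<lambda>n. g (\<alpha> n) / rat_power (\<alpha> n) s) \<longlonglongrightarrow> a"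
proof -
  have "\<not> (\<forall>\<^sub>F n in sequentially. g (\<alpha> n) = 0)"
  proof
    assume "\<forall>\<^sub>F n in sequentially. g (\<alpha> n) = 0"
    then have "\<forall>\<^sub>F n in sequentially. \<bar>g (\<alpha> n)\<bar> \<le> \<bar>0 (\<alpha> n)\<bar>" by eventually_elim simp
    moreover have "0 \<in> P" by (rule subspace_0[OF order_idealD(2)[OF P]])
    ultimately show False using order_ideal_eventually_le[OF P e _ g(1)] g(2) by blast
  qed
  then show ?thesis using germ_fun_leading_term[OF g(1)] that by blast
qed

section \<open>The prime ideal attached to an exponent\<close>

definition small_o_ideal :: "rat set \<Rightarrow> rat \<Rightarrow> (real \<Rightarrow> real) set" where
  "small_o_ideal T x = {f \<in> germ_fun T. (\<lambda>n. f (\<alpha> n) / rat_power (\<alpha> n) x) \<longlonglongrightarrow> 0}"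

text \<open>Monomials are the test functions that show these ideals to be proper and
  distinct.\<close>

lemma monomial_small_o_ideal_iff:
  assumes "s \<in> T" "s \<ge> 0" "s \<ge> x"
  shows "monomial s \<in> small_o_ideal T x \<longleftrightarrow> x < s"
proof -
  have "monomial s (\<alpha> n) / rat_power (\<alpha> n) x = rat_power (\<alpha> n) (s - x)" for n
    by (simp add: monomial_def rat_power_diff)
  then have "monomial s \<in> small_o_ideal T x \<longleftrightarrow> (\<lambda>n. rat_power (\<alpha> n) (s - x)) \<longlonglongrightarrow> 0"
    using monomial_germ_fun[OF assms(1,2)] by (simp add: small_o_ideal_def)
  also have "\<dots> \<longleftrightarrow> x < s"
  proof
    assume "(\<lambda>n. rat_power (\<alpha> n) (s - x)) \<longlonglongrightarrow> 0"
    \<comment> \<open>For \<open>s = x\<close> the quotient is constantly 1.\<close>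
    then have "s \<noteq> x" using LIMSEQ_const_iff[of "1::real" 0] by (auto simp: rat_power_def)
    then show "x < s" using assms(3) by simp
  qed (simp add: rat_power_tendsto_0)
  finally show ?thesis .
qed

text \<open>Primality rests on the eventual sign of \<open>f - g\<close>: on a tail,
  \<open>inf f g\<close> coincides with \<open>f\<close> or with \<open>g\<close>, and membership
  depends on the tail only.\<close>

lemma prime_small_o_ideal:
  assumes x: "x \<in> T" "x \<ge> 0"
  shows "prime_order_ideal (germ_fun T) (small_o_ideal T x)"
proof -
  let ?E = "germ_fun T" and ?P = "small_o_ideal T x"
  have ss: "subspace ?P"
  proof (rule subspaceI)
    show "0 \<in> ?P" using subspace_0[OF subspace_germ_fun] by (simp add: small_o_ideal_def)
  next
    fix f g assume "f \<in> ?P" "g \<in> ?P"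
    then have "f + g \<in> ?E"
      and "(\<lambda>n. f (\<alpha> n) / rat_power (\<alpha> n) x + g (\<alpha> n) / rat_power (\<alpha> n) x) \<longlonglongrightarrow> 0 + 0"
      unfolding small_o_ideal_def
      by (auto intro: subspace_add[OF subspace_germ_fun] simp del: add_0 add_0_right intro!: tendsto_add)
    then show "f + g \<in> ?P" by (simp add: small_o_ideal_def add_divide_distrib)
  next
    fix c f assume "f \<in> ?P"
    then have f: "f \<in> ?E" "(\<lambda>n. f (\<alpha> n) / rat_power (\<alpha> n) x) \<longlonglongrightarrow> 0"
      unfolding small_o_ideal_def by blast+
    have "c *\<^sub>R f \<in> ?E" using f(1) by (rule subspace_scale[OF subspace_germ_fun])
    moreover have "(\<lambda>n. c * (f (\<alpha> n) / rat_power (\<alpha> n) x)) \<longlonglongrightarrow> 0"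
      using f(2) by (rule tendsto_mult_right_zero)
    ultimately show "c *\<^sub>R f \<in> ?P" by (simp add: small_o_ideal_def)
  qed
  have dom: "f \<in> ?P" if f: "f \<in> ?E" and g: "g \<in> ?P" and le: "modulus f \<le> modulus g" for f g
  proof -
    have "\<bar>f t\<bar> \<le> \<bar>g t\<bar>" for t using le by (simp add: le_fun_def)
    then have le: "\<bar>f (\<alpha> n) / rat_power (\<alpha> n) x\<bar> \<le> \<bar>g (\<alpha> n) / rat_power (\<alpha> n) x\<bar>" for n
      using rat_power_pos[of n x] by (simp add: divide_right_mono)
    have "(\<lambda>n. g (\<alpha> n) / rat_power (\<alpha> n) x) \<longlonglongrightarrow> 0"
      using g unfolding small_o_ideal_def by blast
    then have "(\<lambda>n. f (\<alpha> n) / rat_power (\<alpha> n) x) \<longlonglongrightarrow> 0"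
      by (rule tendsto_0_le[where K = 1]) (simp only: real_norm_def mult_1_right le eventually_True)
    then show ?thesis using f by (simp add: small_o_ideal_def)
  qed
  have "monomial x \<notin> ?P"
    using monomial_small_o_ideal_iff[OF x, of x] by simp
  then have proper: "?P \<noteq> ?E"
    using monomial_germ_fun[OF x] by blast
  have prime: "f \<in> ?P \<or> g \<in> ?P" if f: "f \<in> ?E" and g: "g \<in> ?E" and inf: "inf f g \<in> ?P" for f g
  proof -
    have transfer: "h \<in> ?P" if "h \<in> ?E" "\<forall>\<^sub>F n in sequentially. inf f g (\<alpha> n) = h (\<alpha> n)" for h
    proof -
      have "(\<lambda>n. inf f g (\<alpha> n) / rat_power (\<alpha> n) x) \<longlonglongrightarrow> 0"
        using inf unfolding small_o_ideal_def by blast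
      then have "(\<lambda>n. h (\<alpha> n) / rat_power (\<alpha> n) x) \<longlonglongrightarrow> 0"
        by (rule Lim_transform_eventually) (use that(2) in \<open>eventually_elim, simp\<close>)
      then show ?thesis using that(1) by (simp add: small_o_ideal_def)
    qed
    have "f - g \<in> ?E" using subspace_diff[OF subspace_germ_fun f g] .
    from germ_fun_sign[OF this] show ?thesis
    proof
      assume "\<forall>\<^sub>F n in sequentially. 0 \<le> (f - g) (\<alpha> n)"
      then have "\<forall>\<^sub>F n in sequentially. inf f g (\<alpha> n) = g (\<alpha> n)"
        by eventually_elim (simp add: inf_real_def)
      then show ?thesis using transfer[OF g] by blast
    next
      assume "\<forall>\<^sub>F n in sequentially. (f - g) (\<alpha> n) \<le> 0"
      then have "\<forall>\<^sub>F n in sequentially. inf f g (\<alpha> n) = f (\<alpha> n)"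
        by eventually_elim (simp add: inf_real_def)
      then show ?thesis using transfer[OF f] by blast
    qed
  qed
  have sub: "?P \<subseteq> ?E" by (auto simp: small_o_ideal_def)
  show ?thesis
    unfolding prime_order_ideal_def order_ideal_def
  proof (intro conjI ballI impI)
    show "f \<in> ?P" if "f \<in> ?E" "g \<in> ?P" "modulus f \<le> modulus g" for f g
      using that by (rule dom)
    show "f \<in> ?P \<or> g \<in> ?P" if "f \<in> ?E" "g \<in> ?E" "inf f g \<in> ?P" for f g
      using that by (rule prime)
  qed (fact sub ss proper)+
qed

text \<open>Passing from \<open>x\<close> to the smaller \<open>y\<close> multiplies the quotient by
  the null sequence \<open>rat_power (\<alpha> n) (x - y)\<close>.\<close>

lemma small_o_ideal_psubset:
  assumes "x \<in> T" "x \<ge> 0" "y < x"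
  shows "small_o_ideal T x \<subset> small_o_ideal T y"
proof
  show "small_o_ideal T x \<subseteq> small_o_ideal T y"
  proof
    fix f assume f: "f \<in> small_o_ideal T x"
    then have "(\<lambda>n. f (\<alpha> n) / rat_power (\<alpha> n) x * rat_power (\<alpha> n) (x - y)) \<longlonglongrightarrow> 0"
      using assms(3) unfolding small_o_ideal_def
      by (intro tendsto_mult_zero rat_power_tendsto_0) auto
    moreover have "f (\<alpha> n) / rat_power (\<alpha> n) x * rat_power (\<alpha> n) (x - y)
        = f (\<alpha> n) / rat_power (\<alpha> n) y" for n
      using rat_power_pos[of n x] by (simp flip: rat_power_diff)
    ultimately show "f \<in> small_o_ideal T y"
      using f by (simp add: small_o_ideal_def)
  qed
  show "small_o_ideal T x \<noteq> small_o_ideal T y"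
    \<comment> \<open>\<open>monomial x\<close> lies in the ideal for \<open>y\<close> but not in
      the ideal for \<open>x\<close>.\<close>
    using monomial_small_o_ideal_iff[OF assms(1,2)] assms(3) by (metis less_irrefl less_imp_le order_refl)
qed

section \<open>Chain conditions and well-foundedness of the exponents\<close>

text \<open>Larger exponents give smaller ideals, so decreasing sequences of primes correspond to
  increasing exponents, that is, to descending sequences of their negatives.\<close>

lemma prime_artinian_germ_fun_iff:
  assumes T: "T \<subseteq> {0..}"
  shows "prime_artinian (germ_fun T) \<longleftrightarrow> well_founded_poset (uminus ` T)"
proof
  assume art: "prime_artinian (germ_fun T)"
  show "well_founded_poset (uminus ` T)"
  proof (rule ccontr)
    assume "\<not> ?thesis"
    then obtain y where y: "\<And>i::nat. y i \<in> uminus ` T" "\<And>i. y (Suc i) < y i"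
      using not_well_founded_posetE by blast
    have T': "- y i \<in> T" "- y i \<ge> 0" for i using y(1)[of i] T by auto
    let ?P = "\<lambda>i. small_o_ideal T (- y i)"
    have less: "?P (Suc i) \<subset> ?P i" for i
      by (rule small_o_ideal_psubset) (use T' y(2) in auto)
    have "decseq ?P" using less by (intro decseq_SucI) blast
    then have "stationary ?P"
      using spec[OF art[unfolded prime_artinian_def], of ?P] prime_small_o_ideal[OF T'] by simp
    then show False using less unfolding stationary_def by (metis lessI less_imp_le order_refl psubset_eq)
  qed
next
  assume wf: "well_founded_poset (uminus ` T)"
  show "prime_artinian (germ_fun T)"
    unfolding prime_artinian_def
  proof (intro allI impI, elim conjE)
    fix P assume P: "\<forall>n. prime_order_ideal (germ_fun T) (P n)" and dec: "decseq P"
    show "stationary P"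
    proof (cases "\<exists>i n. point_mass n \<notin> P i")
      case True
      then obtain i n where "point_mass n \<notin> P i" by blast
      \<comment> \<open>A point mass missing from \<open>P i\<close> is missing from all later,
        smaller ideals, which are thereby all equal.\<close>
      then have "point_mass n \<notin> P j" if "j \<ge> i" for j
        using decseqD[OF dec that] by blast
      then have "P j = {f \<in> germ_fun T. f (\<alpha> n) = 0}" if "j \<ge> i" for j
        using prime_omits_point_mass P that by blast
      then show ?thesis unfolding stationary_def by (metis order_refl)
    next
      case False
      then have e: "\<And>i n. point_mass n \<in> P i" by blast
      have oi: "order_ideal (germ_fun T) (P i)" for i
        using P prime_order_idealD(1) by blast
      show ?thesis
      proof (rule ccontr)
        assume ns: "\<not> stationary P"
        \<comment> \<open>\<open>L i s\<close> says that some function lost between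
          \<open>P i\<close> and \<open>P (Suc i)\<close> has leading exponent
          \<open>s\<close>.\<close>
        define L where "L i s \<longleftrightarrow> s \<in> T \<and> (\<exists>f a. f \<in> P i \<and> f \<notin> P (Suc i) \<and> a \<noteq> 0 \<and>
          (\<lambda>n. f (\<alpha> n) / rat_power (\<alpha> n) s) \<longlonglongrightarrow> a)" for i s
        have L: "\<exists>j s. j \<ge> N \<and> L j s" for N
        proof -
          obtain j where j: "j \<ge> N" "P (Suc j) \<noteq> P j" using not_stationary_Suc[OF ns] by blast
          then obtain f where f: "f \<in> P j" "f \<notin> P (Suc j)"
            using decseq_SucD[OF dec, of j] by blast
          then have "f \<in> germ_fun T" using order_idealD(1)[OF oi] by blast
          from leading_term_notin_ideal[OF oi e this f(2)] show ?thesis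
            using f j(1) unfolding L_def by metis
        qed
        \<comment> \<open>The function \<open>g\<close> lost at step \<open>i\<close> is outside
          \<open>P j\<close>, while \<open>f\<close>, lost only at step \<open>j\<close>, still
          belongs to \<open>P j\<close>.\<close>
        have less: "r < s" if "L i r" "L j s" "i < j" for i j r s
        proof -
          obtain f a where f: "f \<in> P j" "a \<noteq> 0" "(\<lambda>n. f (\<alpha> n) / rat_power (\<alpha> n) s) \<longlonglongrightarrow> a"
            using \<open>L j s\<close> unfolding L_def by blast
          obtain g b where g: "g \<in> P i" "g \<notin> P (Suc i)" "(\<lambda>n. g (\<alpha> n) / rat_power (\<alpha> n) r) \<longlonglongrightarrow> b"
            using \<open>L i r\<close> unfolding L_def by blast
          have "g \<in> germ_fun T" using g(1) order_idealD(1)[OF oi] by blast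
          moreover have "g \<notin> P j" using g(2) decseqD[OF dec, of "Suc i" j] \<open>i < j\<close> by auto
          ultimately show ?thesis using leading_exponent_less[OF oi e f(1) _ _ f(2,3) g(3)] by blast
        qed
        \<comment> \<open>A minimal element of \<open>X\<close> would come from some jump, but every
          later jump has a larger exponent, hence a smaller negative.\<close>
        define X where "X = {- s | s i. L i s}"
        have "X \<subseteq> uminus ` T" by (auto simp: X_def L_def)
        moreover have "X \<noteq> {}" using L[of 0] by (auto simp: X_def)
        ultimately obtain m where "m \<in> X" and min: "\<forall>x\<in>X. \<not> x < m"
          using wf unfolding well_founded_poset_def by blast
        then obtain i r where ir: "L i r" "m = - r" unfolding X_def by blast
        obtain j s where js: "j \<ge> Suc i" "L j s" using L by blast
        then have "r < s" using less[OF ir(1) js(2)] by simp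
        moreover have "- s \<in> X" using js(2) unfolding X_def by blast
        ultimately show False using min ir(2) by auto
      qed
    qed
  qed
qed

text \<open>The argument mirrors the decreasing case with exponents not negated, since growing
  ideals correspond to falling exponents.\<close>

lemma prime_noetherian_germ_fun_iff:
  assumes T: "T \<subseteq> {0..}"
  shows "prime_noetherian (germ_fun T) \<longleftrightarrow> well_founded_poset T"
proof
  assume noe: "prime_noetherian (germ_fun T)"
  show "well_founded_poset T"
  proof (rule ccontr)
    assume "\<not> ?thesis"
    then obtain x where x: "\<And>i::nat. x i \<in> T" "\<And>i. x (Suc i) < x i"
      using not_well_founded_posetE by blast
    have T': "x i \<ge> 0" for i using x(1)[of i] T by auto
    let ?P = "\<lambda>i. small_o_ideal T (x i)"
    have less: "?P i \<subset> ?P (Suc i)" for i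
      by (rule small_o_ideal_psubset) (use x T' in auto)
    have "incseq ?P" using less by (intro incseq_SucI) blast
    then have "stationary ?P"
      using spec[OF noe[unfolded prime_noetherian_def], of ?P] prime_small_o_ideal[OF x(1) T']
      by simp
    then show False using less unfolding stationary_def by (metis lessI less_imp_le order_refl psubset_eq)
  qed
next
  assume wf: "well_founded_poset T"
  show "prime_noetherian (germ_fun T)"
    unfolding prime_noetherian_def
  proof (intro allI impI, elim conjE)
    fix P assume P: "\<forall>n. prime_order_ideal (germ_fun T) (P n)" and inc: "incseq P"
    have oi: "order_ideal (germ_fun T) (P i)" and proper: "P i \<noteq> germ_fun T" for i
      using P prime_order_idealD(1,2) by blast+
    have sub: "P i \<subseteq> germ_fun T" and ss: "subspace (P i)" for i
      using order_idealD(1,2)[OF oi] by blast+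
    show "stationary P"
    proof (cases "\<exists>i n. point_mass n \<notin> P i")
      case True
      then obtain i n where i: "point_mass n \<notin> P i" by blast
      \<comment> \<open>Unlike in the decreasing case, the point mass might enter a later ideal. But
        \<open>P i\<close> consists of the functions vanishing at \<open>\<alpha> n\<close>, and
        together with the point mass these span everything, so properness excludes it.\<close>
      have "point_mass n \<notin> P j" if "j \<ge> i" for j
      proof
        assume e: "point_mass n \<in> P j"
        have "f \<in> P j" if f: "f \<in> germ_fun T" for f
        proof -
          let ?g = "f - f (\<alpha> n) *\<^sub>R point_mass n"
          have "?g \<in> germ_fun T"
            by (intro subspace_diff subspace_scale subspace_germ_fun f point_mass_germ_fun)
          moreover have "?g (\<alpha> n) = 0" by (simp add: point_mass_seq)
          ultimately have "?g \<in> P i" using prime_omits_point_mass[OF _ i] P by blast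
          then have "?g \<in> P j" using incseqD[OF inc \<open>j \<ge> i\<close>] by blast
          then have "?g + f (\<alpha> n) *\<^sub>R point_mass n \<in> P j"
            by (intro subspace_add subspace_scale ss e)
          then show ?thesis by simp
        qed
        then show False using sub[of j] proper[of j] by blast
      qed
      then have "P j = {f \<in> germ_fun T. f (\<alpha> n) = 0}" if "j \<ge> i" for j
        using prime_omits_point_mass P that by blast
      then show ?thesis unfolding stationary_def by (metis order_refl)
    next
      case False
      then have e: "\<And>i n. point_mass n \<in> P i" by blast
      show ?thesis
      proof (rule ccontr)
        assume ns: "\<not> stationary P"
        \<comment> \<open>Here \<open>s\<close> is the leading exponent of a function gained between
          \<open>P i\<close> and \<open>P (Suc i)\<close>.\<close>
        define L where "L i s \<longleftrightarrow> s \<in> T \<and> (\<exists>f a. f \<in> P (Suc i) \<and> f \<notin> P i \<and> a \<noteq> 0 \<and>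
          (\<lambda>n. f (\<alpha> n) / rat_power (\<alpha> n) s) \<longlonglongrightarrow> a)" for i s
        have L: "\<exists>j s. j \<ge> N \<and> L j s" for N
        proof -
          obtain j where j: "j \<ge> N" "P (Suc j) \<noteq> P j" using not_stationary_Suc[OF ns] by blast
          then obtain f where f: "f \<in> P (Suc j)" "f \<notin> P j"
            using incseq_SucD[OF inc, of j] by blast
          then have "f \<in> germ_fun T" using sub by blast
          from leading_term_notin_ideal[OF oi e this f(2)] show ?thesis
            using f j(1) unfolding L_def by metis
        qed
        \<comment> \<open>The function \<open>f\<close> gained at step \<open>i\<close> belongs to
          \<open>P j\<close>, while \<open>g\<close>, gained only at step \<open>j\<close>, does
          not.\<close>
        have less: "s < r" if "L i r" "L j s" "i < j" for i j r s
        proof -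
          obtain f a where f: "f \<in> P (Suc i)" "a \<noteq> 0" "(\<lambda>n. f (\<alpha> n) / rat_power (\<alpha> n) r) \<longlonglongrightarrow> a"
            using \<open>L i r\<close> unfolding L_def by blast
          obtain g b where g: "g \<in> P (Suc j)" "g \<notin> P j" "(\<lambda>n. g (\<alpha> n) / rat_power (\<alpha> n) s) \<longlonglongrightarrow> b"
            using \<open>L j s\<close> unfolding L_def by blast
          have "g \<in> germ_fun T" using g(1) sub by blast
          moreover have "f \<in> P j" using f(1) incseqD[OF inc, of "Suc i" j] \<open>i < j\<close> by auto
          ultimately show ?thesis using leading_exponent_less[OF oi e _ _ g(2) f(2,3) g(3)] by blast
        qed
        define X where "X = {s. \<exists>i. L i s}"
        have "X \<subseteq> T" by (auto simp: X_def L_def)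
        moreover have "X \<noteq> {}" using L[of 0] by (auto simp: X_def)
        ultimately obtain m where "m \<in> X" and min: "\<forall>x\<in>X. \<not> x < m"
          using wf unfolding well_founded_poset_def by blast
        then obtain i where i: "L i m" unfolding X_def by blast
        obtain j s where js: "j \<ge> Suc i" "L j s" using L by blast
        then have "s < m" using less[OF i js(2)] by simp
        moreover have "s \<in> X" using js(2) unfolding X_def by blast
        ultimately show False using min by auto
      qed
    qed
  qed
qed

end

theorem mainTheorem5:
  fixes \<alpha> :: "nat \<Rightarrow> real" and K :: "real set" and S :: "rat set"
  assumes "\<And>m n. m < n \<Longrightarrow> \<alpha> n < \<alpha> m"
    and "\<alpha> \<longlonglongrightarrow> 0"
    and "K = range \<alpha> \<union> {0}"
    and "S \<subseteq> {0<..}"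
  shows "(prime_artinian (M0_fun S K) \<longleftrightarrow>
            well_founded_poset (uminus ` S) \<and> forest (uminus ` S) \<and> finite_width (uminus ` S)) \<and>
         (prime_artinian (R_fun S K) \<longleftrightarrow>
            well_founded_poset (uminus ` S) \<and> forest (uminus ` S) \<and> finite_width (uminus ` S)) \<and>
         (prime_noetherian (M0_fun S K) \<longleftrightarrow>
            well_founded_poset S \<and> forest S \<and> finite_width S) \<and>
         (prime_noetherian (R_fun S K) \<longleftrightarrow>
            well_founded_poset S \<and> forest S \<and> finite_width S)"
proof -
  interpret decreasing_null_sequence \<alpha>
    by unfold_locales (use assms in auto)
  have S: "S \<subseteq> {0..}" "insert 0 S \<subseteq> {0..}" using assms(4) by force+
  show ?thesis
    \<comment> \<open>Both lattices become \<open>germ_fun T\<close>, with \<open>T = S\<close> and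
      \<open>T = insert 0 S\<close>. What remains is that adjoining 0 does not affect
      well-foundedness and that linear orders are forests of finite width.\<close>
    unfolding assms(3) M0_fun_eq_germ_fun[OF assms(4)] R_fun_eq_germ_fun[OF assms(4)]
      prime_artinian_germ_fun_iff[OF S(1)] prime_artinian_germ_fun_iff[OF S(2)]
      prime_noetherian_germ_fun_iff[OF S(1)] prime_noetherian_germ_fun_iff[OF S(2)]
    by (simp add: well_founded_poset_insert_iff forest_linorder finite_width_linorder)
qed

end
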